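(* Let $E\subseteq[0,1]$ be a closed set of positive Fourier dimension. Then $E$ contains a nontrivial translation-invariant rational linear pattern; that is, there exist an integer $v\ge2$, a function $f\in\mathcal F_v(\mathbb N)$, and a point $(x_0,\ldots,x_v)\in E^{v+1}$ with all entries distinct such that $f(x_0,\ldots,x_v)=0$.
   Context: $\mathbb N=\{1,2,\ldots\}$. The Fourier transform of a measure $\mu$ is $\widehat\mu(\xi)=\int e^{-ix\xi}\,d\mu(x)$. The Fourier dimension $\dim_{\mathbb F}(A)$ of a Borel set $A\subseteq\mathbb R$ is the supremum of exponents $\beta\le 1$ for which there exist a probability measure $\mu$ supported on $A$ and a finite constant $C_2>0$ with $|\widehat\mu(\xi)|\le C_2(1+|\xi|)^{-\beta/2}$ for all $\xi\in\mathbb R$. For $v\ge2$, $\mathcal F_v(\mathbb N)$ is the set of functions $f(x_0,\ldots,x_v)=m_0x_0-\sum_{i=1}^v m_ix_i$ with $m_0,\ldots,m_v\in\mathbb N$, $m_0=\sum_{i=1}^v m_i$ and $\gcd(m_0,m_1,\ldots,m_v)=1$. *)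

theory Defs
  imports "HOL-Probability.Probability"
begin

definition fourier_transform :: "real measure \<Rightarrow> real \<Rightarrow> complex" where
  "fourier_transform \<mu> \<xi> = (CLINT x|\<mu>. exp (- \<i> * complex_of_real (x * \<xi>)))"

lemma fourier_transform_conv_char: "fourier_transform \<mu> \<xi> = char \<mu> (- \<xi>)"
  by (simp add: fourier_transform_def char_def mult.commute)

(* A Borel probability measure mu is supported on A if mu(A) = 1.  For closed A this
   says exactly that the closed support of mu is contained in A. *)
definition fourier_decay_exponent :: "real set \<Rightarrow> real \<Rightarrow> bool" where
  "fourier_decay_exponent A \<beta> \<longleftrightarrow>
     (\<exists>\<mu> C. real_distribution \<mu> \<and> emeasure \<mu> A = 1 \<and> 0 < C \<and>
        (\<forall>\<xi>. cmod (fourier_transform \<mu> \<xi>) \<le> C * (1 + \<bar>\<xi>\<bar>) powr (- \<beta> / 2)))"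

(* The supremum is taken in the extended reals because it ranges over the empty set when A
   is empty, and the supremum of the empty set is unspecified in type real; here it is
   -\<infinity>.  For nonempty Borel A the value lies in [0,1]. *)
definition fourier_dimension :: "real set \<Rightarrow> ereal" where
  "fourier_dimension A = Sup (ereal ` {\<beta>. \<beta> \<le> 1 \<and> fourier_decay_exponent A \<beta>})"

(* The set F_v(N).  A point (x_0,...,x_v) is a function on nat of which only the values
   at 0,...,v matter. *)
definition pattern_functions :: "nat \<Rightarrow> ((nat \<Rightarrow> real) \<Rightarrow> real) set" where
  "pattern_functions v =
     {(\<lambda>x. real (m 0) * x 0 - (\<Sum>i=1..v. real (m i) * x i)) | m :: nat \<Rightarrow> nat.
        (\<forall>i\<in>{0..v}. 1 \<le> m i) \<and> m 0 = (\<Sum>i=1..v. m i) \<and> Gcd (m ` {0..v}) = 1}"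

end

(*
  If mu decays like |xi|^(-beta/2), then mu^{*n} with n beta / 2 >= 3 decays so fast that Levy's
  inversion formula makes the averages of mu^{*n} over an interval and over a subinterval nearly
  equal.  A gap of the closed set E + ... + E in every interval would thus force mu^{*n} = 0, so
  this n-fold sum set contains an interval.  Take a < x0 < b in E.  The numbers
  r (x0 - a) - t (b - x0) with positive rational r, t are dense in the reals, hence some n-fold sum
  s satisfies s - n x0 = r (x0 - a) - t (b - x0), which exhibits x0 as a rational convex combination
  of a, b and the summands of s.  Collecting equal points makes all points distinct.
*)
theory Submission
  imports Defs
begin

section \<open>Levy inversion and averages over intervals\<close>

lemma norm_iexp_diff_le: "cmod (iexp x - iexp y) \<le> \<bar>x - y\<bar>"
proof -
  have "iexp x - iexp y = iexp y * (iexp (x - y) - 1)"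
    by (simp add: algebra_simps flip: exp_add)
  then have "cmod (iexp x - iexp y) = cmod (iexp (x - y) - 1)"
    by (simp add: norm_mult)
  also have "\<dots> \<le> \<bar>x - y\<bar>"
    using iexp_approx1[of "x - y" 0] by simp
  finally show ?thesis .
qed

text \<open>The quotient of Levy's kernel by \<open>d - c\<close> is the mean of
  \<open>iexp (-(t * x))\<close> over \<open>x\<close> in \<open>{c..d}\<close>. Each of these
  values is within \<open>\<bar>t\<bar> * (x - a)\<close> of the value at \<open>a\<close>, so the
  mean is as close as claimed.\<close>

lemma Levy_kernel_approx:
  fixes a b c d t :: real
  assumes "a \<le> c" "c < d" "d \<le> b" "t \<noteq> 0"
  shows "cmod ((iexp (-(t * c)) - iexp (-(t * d))) / (\<i> * t) / (d - c) - iexp (-(t * a))) \<le> \<bar>t\<bar> * (b - a)"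
proof -
  \<comment> \<open>\<open>H\<close> is an antiderivative of
    \<open>iexp (-(t * x)) - iexp (-(t * a))\<close>. The linear term makes
    \<open>(H d - H c) / (d - c)\<close> exactly the quantity to be estimated, so the mean value
    inequality applies.\<close>
  define H where "H x = - iexp (-(t * x)) / (\<i> * t) - x *\<^sub>R iexp (-(t * a))" for x :: real
  have "cmod (H d - H c) \<le> (\<bar>t\<bar> * (b - a)) * norm (d - c)"
  proof (rule differentiable_bound[where S="{c..d}"])
    fix x assume x: "x \<in> {c..d}"
    have "(H has_vector_derivative (iexp (-(t * x)) - iexp (-(t * a)))) (at x within {c..d})"
    proof -
      have "((\<lambda>x. exp (x *\<^sub>R (- \<i> * t))) has_vector_derivative exp (x *\<^sub>R (- \<i> * t)) * (- \<i> * t)) (at x within {c..d})"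
        by (rule exp_scaleR_has_vector_derivative_right)
      then have "((\<lambda>x. iexp (-(t * x))) has_vector_derivative iexp (-(t * x)) * (- \<i> * t)) (at x within {c..d})"
        by (simp add: scaleR_conv_of_real mult_ac)
      then show ?thesis
        unfolding H_def using assms by (auto intro!: derivative_eq_intros)
    qed
    then show "(H has_derivative (\<lambda>h. h *\<^sub>R (iexp (-(t * x)) - iexp (-(t * a))))) (at x within {c..d})"
      by (simp add: has_vector_derivative_def)
    have "onorm (\<lambda>h. h *\<^sub>R (iexp (-(t * x)) - iexp (-(t * a)))) \<le> cmod (iexp (-(t * x)) - iexp (-(t * a)))"
      by (rule onorm_bound) (auto simp: mult.commute)
    also have "\<dots> \<le> \<bar>t * a - t * x\<bar>"
      using norm_iexp_diff_le[of "-(t*x)" "-(t*a)"] by simp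
    also have "\<dots> = \<bar>t\<bar> * (x - a)"
      using x assms by (simp add: abs_mult flip: right_diff_distrib)
    also have "\<dots> \<le> \<bar>t\<bar> * (b - a)"
      using x assms by (intro mult_left_mono) auto
    finally show "onorm (\<lambda>h. h *\<^sub>R (iexp (-(t * x)) - iexp (-(t * a)))) \<le> \<bar>t\<bar> * (b - a)" .
  qed (use assms in auto)
  moreover have "(iexp (-(t * c)) - iexp (-(t * d))) / (\<i> * t) / (d - c) - iexp (-(t * a)) = (H d - H c) / (d - c)"
    using assms by (simp add: H_def field_simps scaleR_conv_of_real)
  ultimately show ?thesis
    using assms by (simp add: norm_divide divide_simps flip: of_real_diff)
qed

text \<open>After division by the lengths, both inversion kernels are close to the same
  \<open>iexp (-(t * a))\<close>, so they differ by at most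
  \<open>2 * \<bar>t\<bar> * (b - a)\<close>. Integrating against \<open>char M\<close> with Levy's
  factor \<open>1 / (2 * pi)\<close> gives the bound. The endpoints must not be atoms, since
  inversion recovers the mass of an interval only then.\<close>

lemma (in real_distribution) average_diff_le:
  fixes a b c d :: real
  assumes int: "integrable lborel (\<lambda>t. \<bar>t\<bar> * cmod (char M t))"
    and le: "a \<le> c" "c < d" "d \<le> b"
    and null: "measure M {a} = 0" "measure M {b} = 0" "measure M {c} = 0" "measure M {d} = 0"
  shows "\<bar>measure M {a<..b} / (b - a) - measure M {c<..d} / (d - c)\<bar>
    \<le> (LBINT t. \<bar>t\<bar> * cmod (char M t)) / pi * (b - a)"
proof -
  define k where "k c d t = (iexp (-(t * c)) - iexp (-(t * d))) / (\<i> * t)" for c d t :: real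
  define K where "K = (LBINT t. \<bar>t\<bar> * cmod (char M t))"
  define J where "J c d T = 1 / (2 * pi) * (CLBINT t=-T..T. k c d t * char M t)" for c d T :: real
  have [measurable]: "k c d \<in> borel_measurable borel" for c d
    unfolding k_def by measurable
  have int1: "integrable lborel (\<lambda>t. indicator {-T<..<T} t *\<^sub>R (k c d t * char M t))" if "c \<le> d" for c d T :: real
  proof (rule integrableI_bounded_set_indicator[where B="d - c"])
    show "AE t in lborel. t \<in> {-T<..<T} \<longrightarrow> cmod (k c d t * char M t) \<le> d - c"
    \<comment> \<open>The kernel estimate requires \<open>t \<noteq> 0\<close>, so the origin is put
      into a null set.\<close>
    proof (intro AE_I[of _ _ "{0}"] subsetI; clarsimp)
      fix t :: real
      assume "\<not> cmod (k c d t * char M t) \<le> d - c"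
      moreover have "cmod (k c d t) \<le> d - c" if "t \<noteq> 0"
        using Levy_Inversion_aux2[of "-d" "-c" t] that \<open>c \<le> d\<close> by (simp add: k_def)
      then have "cmod (k c d t * char M t) \<le> (d - c) * 1" if "t \<noteq> 0"
        unfolding norm_mult using that cmod_char_le_1[of t] \<open>c \<le> d\<close> by (intro mult_mono) auto
      ultimately show "t = 0" by auto
    qed
      show "emeasure lborel {-T<..<T} < \<infinity>"
      by (rule emeasure_bounded_finite) auto
  qed auto
  have J: "(\<lambda>T::nat. J c d T) \<longlonglongrightarrow> of_real (measure M {c<..d})"
    if "c \<le> d" "measure M {c} = 0" "measure M {d} = 0" for c d
    using Levy_Inversion[of c d] that unfolding J_def k_def by simp
  \<comment> \<open>The bound does not depend on the truncation \<open>T\<close>, so it survives the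
    limit in Levy's formula.\<close>
  have "cmod (J a b T / (b - a) - J c d T / (d - c)) \<le> K / pi * (b - a)" if "T \<ge> 0" for T :: real
  proof -
    let ?I = "indicat_real {-T<..<T}"
    let ?D = "\<lambda>t. ?I t *\<^sub>R (k a b t * char M t) / (b - a) - ?I t *\<^sub>R (k c d t * char M t) / (d - c)"
    have "J a b T / (b - a) - J c d T / (d - c) = 1 / (2 * pi) * (CLBINT t. ?D t)"
      using that int1[of a b T] int1[of c d T] le unfolding J_def
      by (subst Bochner_Integration.integral_diff)
        (auto simp: interval_lebesgue_integral_def set_lebesgue_integral_def right_diff_distrib)
    then have "cmod (J a b T / (b - a) - J c d T / (d - c)) = 1 / (2 * pi) * cmod (CLBINT t. ?D t)"
      by (simp add: norm_mult norm_divide)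
    also have "\<dots> \<le> 1 / (2 * pi) * (LBINT t. (2 * (b - a)) * (\<bar>t\<bar> * cmod (char M t)))"
    proof (rule mult_left_mono)
      show "cmod (CLBINT t. ?D t)
        \<le> (LBINT t. (2 * (b - a)) * (\<bar>t\<bar> * cmod (char M t)))"
      proof (rule Bochner_Integration.integral_norm_bound_integral)
        show "integrable lborel (\<lambda>t. ?D t)"
          using int1[of a b T] int1[of c d T] le
          by (intro Bochner_Integration.integrable_diff integrable_divide) simp_all
        show "integrable lborel (\<lambda>t. (2 * (b - a)) * (\<bar>t\<bar> * cmod (char M t)))"
          using int by (intro integrable_mult_right)
        fix t :: real
        have "cmod (k a b t / (b - a) - k c d t / (d - c)) \<le> 2 * (\<bar>t\<bar> * (b - a))"
        \<comment> \<open>At the origin division by zero gives both kernels the value 0, and the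
          claim reads \<open>0 \<le> 0\<close>.\<close>
        proof (cases "t = 0")
          case False
          have "cmod (k a b t / (b - a) - k c d t / (d - c)) \<le>
             cmod (k a b t / (b - a) - iexp (-(t*a))) + cmod (k c d t / (d - c) - iexp (-(t*a)))"
            using norm_triangle_ineq4[of "k a b t / (b - a) - iexp (-(t*a))" "k c d t / (d - c) - iexp (-(t*a))"]
            by simp
          also have "\<dots> \<le> \<bar>t\<bar> * (b - a) + \<bar>t\<bar> * (b - a)"
            unfolding k_def using le False by (intro add_mono Levy_kernel_approx) simp_all
          finally show ?thesis by simp
        qed (simp add: k_def)
        then have "cmod (k a b t / (b - a) - k c d t / (d - c)) * cmod (char M t)
            \<le> 2 * (\<bar>t\<bar> * (b - a)) * cmod (char M t)"
          by (rule mult_right_mono) simp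
        moreover have "?D t =
            ?I t *\<^sub>R ((k a b t / (b - a) - k c d t / (d - c)) * char M t)"
          by (simp add: scaleR_conv_of_real algebra_simps)
        ultimately show "cmod (?D t)
            \<le> (2 * (b - a)) * (\<bar>t\<bar> * cmod (char M t))"
          using le by (simp add: norm_mult indicator_def mult_ac)
      qed
    qed simp
    also have "\<dots> = K / pi * (b - a)"
      unfolding K_def by (subst integral_mult_right_zero) (simp add: field_simps)
    finally show ?thesis .
  qed
  moreover have "(\<lambda>T::nat. cmod (J a b T / (b - a) - J c d T / (d - c)))
      \<longlonglongrightarrow> cmod (complex_of_real (measure M {a<..b}) / (b - a) - complex_of_real (measure M {c<..d}) / (d - c))"
    using le null by (intro tendsto_norm tendsto_diff tendsto_divide tendsto_const J) auto
  ultimately have "cmod (complex_of_real (measure M {a<..b}) / (b - a) - complex_of_real (measure M {c<..d}) / (d - c))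
      \<le> K / pi * (b - a)"
    by (intro LIMSEQ_le_const2) auto
  then show ?thesis
    unfolding K_def by (simp flip: of_real_diff of_real_divide)
qed

text \<open>If the closed set \<open>S\<close> had empty interior, every interval would contain a
  subinterval missing \<open>S\<close>, on which the average of \<open>M\<close> is 0. By
  \<open>average_diff_le\<close> the mass of an interval is then at most quadratic in its length.
  Cutting a bounded range into \<open>N\<close> equal pieces makes the total mass of order
  \<open>1 / N\<close>, against full mass on \<open>S\<close>.\<close>

lemma (in real_distribution) interior_nonempty_of_full_measure:
  assumes int: "integrable lborel (\<lambda>t. \<bar>t\<bar> * cmod (char M t))"
    and S: "closed S" "bounded S" "measure M S = 1"
  shows "interior S \<noteq> {}"
proof
  assume empty: "interior S = {}"
  define K where "K = (LBINT t. \<bar>t\<bar> * cmod (char M t)) / pi"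
  have [measurable, simp]: "S \<in> sets borel"
    using S by auto
  have atoms: "countable {x. measure M {x} \<noteq> 0}"
    by (rule countable_support)
  have small: "measure M {a<..b} \<le> K * (b - a)\<^sup>2"
    if ab: "a < b" "measure M {a} = 0" "measure M {b} = 0" for a b
  proof -
    have "\<not> {a<..<b} \<subseteq> S"
      using interior_maximal[of "{a<..<b}" S] empty ab(1) dense[of a b] by auto
    then obtain x where x: "x \<in> {a<..<b} - S" by blast
    have "open ({a<..<b} - S)"
      using S by (intro open_Diff) auto
    then obtain e where e: "e > 0" "ball x e \<subseteq> {a<..<b} - S"
      using x open_contains_ball by blast
    \<comment> \<open>There are only countably many atoms, so admissible endpoints exist on either
      side of \<open>x\<close> inside the ball.\<close>
    obtain c where c: "c \<in> {x - e<..<x}" "measure M {c} = 0"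
      using open_minus_countable[OF atoms, of "{x - e<..<x}"] e by auto
    obtain d where d: "d \<in> {x<..<x + e}" "measure M {d} = 0"
      using open_minus_countable[OF atoms, of "{x<..<x + e}"] e by auto
    have sub: "{c..d} \<subseteq> {a<..<b} - S"
      using c d by (intro subset_trans[OF _ e(2)]) (auto simp: dist_real_def)
    have "S \<inter> {c<..d} = {}"
      using sub greaterThanAtMost_subseteq_atLeastAtMost_iff[of c d c d] by blast
    then have "measure M S + measure M {c<..d} = measure M (S \<union> {c<..d})"
      by (subst finite_measure_Union) auto
    also have "\<dots> \<le> 1" by simp
    finally have "measure M {c<..d} = 0"
      using S by (simp add: measure_le_0_iff)
    moreover have "c \<in> {c..d}" "d \<in> {c..d}" using c d by auto
    then have "c \<in> {a<..<b}" "d \<in> {a<..<b}"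
      using sub by blast+
    then have "a < c" "c < d" "d < b"
      using c d by auto
    ultimately have "measure M {a<..b} / (b - a) \<le> K * (b - a)"
      using average_diff_le[OF int, of a c d b] c d ab by (simp add: K_def)
    then show ?thesis
      using ab by (simp add: field_simps power2_eq_square)
  qed
  obtain R where R: "R > 0" "\<And>x. x \<in> S \<Longrightarrow> \<bar>x\<bar> \<le> R"
    using S(2) unfolding bounded_pos by auto
  \<comment> \<open>The starting point \<open>a\<close> will lie within distance 1 to the left of
    \<open>-R\<close>, so length \<open>2 * R + 1\<close> suffices to cover \<open>S\<close>. The
    choice of \<open>N\<close> makes the final total \<open>K * L\<^sup>2 / N\<close> less than
    1.\<close>
  define L where "L = 2 * R + 1"
  obtain N :: nat where N: "K * L\<^sup>2 < real N" "N > 0"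
    using reals_Archimedean2[of "max 0 (K * L\<^sup>2)"] by auto
  define h where "h = L / N"
  have "h > 0" using R N by (simp add: h_def L_def)
  \<comment> \<open>A starting point outside this countable set makes all grid points
    \<open>a + h * k\<close> non-atoms simultaneously.\<close>
  define B where "B = (\<Union>k::nat. (\<lambda>x. x - h * k) ` {x. measure M {x} \<noteq> 0})"
  have "\<exists>a\<in>{-R-1<..<-R}. a \<notin> B"
    by (rule open_minus_countable) (use atoms in \<open>auto simp: B_def\<close>)
  then obtain a where a: "a \<in> {-R-1<..<-R}" "a \<notin> B" by blast
  have nonatom: "measure M {a + h * k} = 0" for k :: nat
  proof (rule ccontr)
    assume "measure M {a + h * k} \<noteq> 0"
    then have "(a + h * k) - h * k \<in> (\<lambda>x. x - h * k) ` {x. measure M {x} \<noteq> 0}"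
      by blast
    then show False using a(2) unfolding B_def by auto
  qed
  have grid: "measure M {a<..a + h * k} \<le> k * (K * h\<^sup>2)" for k :: nat
  proof (induction k)
    case (Suc k)
    have "a \<le> a + h * k" "a + h * k \<le> a + h * Suc k"
      using \<open>h > 0\<close> by simp_all
    then have "{a<..a + h * Suc k} = {a<..a + h * k} \<union> {a + h * k<..a + h * Suc k}"
      by (simp only: ivl_disj_un)
    also have "measure M \<dots> \<le> measure M {a<..a + h * k} + measure M {a + h * k<..a + h * Suc k}"
      by (intro measure_Un_le) auto
    also have "\<dots> \<le> k * (K * h\<^sup>2) + K * h\<^sup>2"
      using small[of "a + h * k" "a + h * Suc k"] nonatom[of k] nonatom[of "Suc k"] \<open>h > 0\<close> Suc
      by (intro add_mono) (auto simp: algebra_simps)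
    finally show ?case by (simp add: algebra_simps)
  qed simp
  have "h * N = L"
    using N by (simp add: h_def)
  then have "S \<subseteq> {a<..a + h * N}"
    using R(2) a(1) by (force simp: L_def abs_le_iff)
  then have "1 \<le> measure M {a<..a + h * N}"
    using finite_measure_mono[of S "{a<..a + h * N}"] S(3) by simp
  also have "\<dots> \<le> N * (K * h\<^sup>2)" by (rule grid)
  also have "\<dots> = K * L\<^sup>2 / N"
    using N by (simp add: h_def power2_eq_square field_simps)
  also have "\<dots> < 1" using N by simp
  finally show False by simp
qed

section \<open>Sum sets and convolution powers\<close>

primrec nfold_sum :: "nat \<Rightarrow> 'a::comm_monoid_add set \<Rightarrow> 'a set" where
  "nfold_sum 0 E = {0}"
| "nfold_sum (Suc n) E = {x + y | x y. x \<in> nfold_sum n E \<and> y \<in> E}"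

lemma compact_nfold_sum:
  fixes E :: "'a::real_normed_vector set"
  shows "compact E \<Longrightarrow> compact (nfold_sum n E)"
  by (induction n) (simp_all add: compact_sums)

lemma sum_mem_nfold_sum: "(\<And>i. i < n \<Longrightarrow> f i \<in> E) \<Longrightarrow> (\<Sum>i<n. f i) \<in> nfold_sum n E"
  by (induction n) auto

text \<open>A list keeps the multiplicities of the summands, which later become integer
  weights.\<close>

lemma nfold_sum_imp_list:
  "s \<in> nfold_sum n E \<Longrightarrow> \<exists>xs. length xs = n \<and> set xs \<subseteq> E \<and> sum_list xs = s"
proof (induction n arbitrary: s)
  case (Suc n)
  then obtain x y where s: "s = x + y" "x \<in> nfold_sum n E" "y \<in> E" by auto
  with Suc.IH obtain xs where "length xs = n" "set xs \<subseteq> E" "sum_list xs = x" by blast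
  with s show ?case by (intro exI[of _ "y # xs"]) (auto simp: add.commute)
qed simp

text \<open>Independence means that the joint law of the coordinates is the product of their laws.
  Here the joint map is restriction to \<open>I\<close>, which is the identity on the space of
  \<open>PiM I N\<close>, and each coordinate has law \<open>N i\<close>.\<close>

lemma indep_vars_PiM_coordinates:
  assumes "I \<noteq> {}" "\<And>i. i \<in> I \<Longrightarrow> prob_space (N i)"
  shows "prob_space.indep_vars (PiM I N) N (\<lambda>i \<omega>. \<omega> i) I"
proof -
  interpret P: prob_space "PiM I N"
    using assms by (intro prob_space_PiM)
  have "distr (PiM I N) (PiM I N) (\<lambda>\<omega>. restrict \<omega> I) = distr (PiM I N) (PiM I N) (\<lambda>\<omega>. \<omega>)"
    by (intro distr_cong) (auto simp: space_PiM)
  also have "\<dots> = PiM I (\<lambda>i. distr (PiM I N) (N i) (\<lambda>\<omega>. \<omega> i))"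
    using assms by (auto intro!: PiM_cong simp: distr_PiM_component)
  finally show ?thesis
    using assms by (subst P.indep_vars_iff_distr_eq_PiM') auto
qed

text \<open>The witness is the \<open>n\<close>-fold convolution power of \<open>M\<close>, realised
  as the law of the sum of the coordinates of a product space. Independence turns its characteristic
  function into a power, and almost surely all coordinates lie in \<open>E\<close>.\<close>

lemma (in real_distribution) ex_iid_sum:
  assumes n: "n > 0" and E: "compact E" "measure M E = 1"
  shows "\<exists>N. real_distribution N \<and> (\<forall>t. char N t = char M t ^ n) \<and> measure N (nfold_sum n E) = 1"
proof -
  define P where "P = PiM {..<n} (\<lambda>_::nat. M)"
  interpret P: prob_space P
    unfolding P_def by (intro prob_space_PiM prob_space_axioms)
  have coord [measurable]: "(\<lambda>\<omega>. \<omega> i) \<in> borel_measurable P" if "i < n" for i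
    using that unfolding P_def measurable_cong_sets[OF refl events_eq_borel[symmetric]] by simp
  have distr_coord: "distr P borel (\<lambda>\<omega>. \<omega> i) = M" if "i < n" for i
  proof -
    have "distr P borel (\<lambda>\<omega>. \<omega> i) = distr P M (\<lambda>\<omega>. \<omega> i)"
      by (intro distr_cong) auto
    then show ?thesis
      using that distr_PiM_component[of "{..<n}" "\<lambda>_. M" i] prob_space_axioms by (simp add: P_def)
  qed
  have "P.indep_vars (\<lambda>_. M) (\<lambda>i \<omega>. \<omega> i) {..<n}"
    unfolding P_def using n prob_space_axioms by (intro indep_vars_PiM_coordinates) auto
  \<comment> \<open>\<open>M\<close> and \<open>borel\<close> have the same measurable sets, so
    independence carries over.\<close>
  then have indep: "P.indep_vars (\<lambda>_. borel) (\<lambda>i \<omega>. \<omega> i) {..<n}"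
    by (simp add: P.indep_vars_def2 measurable_cong_sets[OF refl events_eq_borel])
  define N where "N = distr P borel (\<lambda>\<omega>. \<Sum>i<n. \<omega> i)"
  have meas [measurable]: "(\<lambda>\<omega>. \<Sum>i<n. \<omega> i) \<in> borel_measurable P"
    by (intro borel_measurable_sum) auto
  have "AE x in M. x \<in> E"
    using E by (intro prob_eq_1[THEN iffD1]) (auto intro: borel_compact)
  then have "AE \<omega> in P. \<omega> i \<in> E" if "i < n" for i
    unfolding P_def using that prob_space_axioms by (intro AE_PiM_component) auto
  then have "AE \<omega> in P. \<forall>i\<in>{..<n}. \<omega> i \<in> E"
    by (intro AE_finite_allI) auto
  then have "AE \<omega> in P. (\<Sum>i<n. \<omega> i) \<in> nfold_sum n E"
    by eventually_elim (auto intro: sum_mem_nfold_sum)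
  moreover have [measurable]: "nfold_sum n E \<in> sets borel"
    using compact_nfold_sum[OF E(1)] by (auto intro: borel_compact)
  ultimately have "measure N (nfold_sum n E) = 1"
    unfolding N_def by (subst measure_distr) (auto intro!: P.prob_eq_1[THEN iffD2] simp: vimage_def elim: eventually_mono)
  moreover have "char N t = char M t ^ n" for t
    unfolding N_def by (subst P.char_distr_sum[OF indep]) (simp add: distr_coord)
  moreover have "real_distribution N"
    unfolding N_def by (intro P.real_distribution_distr meas)
  ultimately show ?thesis by blast
qed

text \<open>The factor \<open>\<bar>t\<bar>\<close> costs one power of
  \<open>1 + \<bar>t\<bar>\<close>, and the remaining exponent -2 allows comparison with the
  integrable \<open>inverse (1 + t\<^sup>2)\<close>.\<close>

lemma integrable_of_char_decay:
  fixes g :: "real \<Rightarrow> complex"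
  assumes [measurable]: "g \<in> borel_measurable borel"
    and bound: "\<And>t. cmod (g t) \<le> C * (1 + \<bar>t\<bar>) powr (-3)"
  shows "integrable lborel (\<lambda>t. \<bar>t\<bar> * cmod (g t))"
proof (rule Bochner_Integration.integrable_bound)
  have "integrable lborel (\<lambda>t::real. inverse (1 + t\<^sup>2))"
    using integrable_inverse_1_plus_square by (simp add: set_integrable_def)
  then show "integrable lborel (\<lambda>t::real. C * inverse (1 + t\<^sup>2))"
    by simp
  show "AE t in lborel. norm (\<bar>t\<bar> * cmod (g t)) \<le> norm (C * inverse (1 + t\<^sup>2))"
  proof (rule AE_I2)
    fix t :: real
    have "0 \<le> C"
      using order_trans[OF norm_ge_zero bound[of 0]] by simp
    have "\<bar>t\<bar> * (1 + \<bar>t\<bar>) powr (-3) \<le> (1 + \<bar>t\<bar>) powr 1 * (1 + \<bar>t\<bar>) powr (-3)"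
      by (intro mult_right_mono) auto
    also have "\<dots> = inverse ((1 + \<bar>t\<bar>)\<^sup>2)"
      by (simp add: powr_minus powr_numeral power2_eq_square power3_eq_cube)
    also have "\<dots> \<le> inverse (1 + t\<^sup>2)"
      by (intro le_imp_inverse_le) (auto simp: power2_sum intro: add_pos_nonneg)
    finally have "C * (\<bar>t\<bar> * (1 + \<bar>t\<bar>) powr (-3)) \<le> C * inverse (1 + t\<^sup>2)"
      using \<open>0 \<le> C\<close> by (rule mult_left_mono)
    moreover have "\<bar>t\<bar> * cmod (g t) \<le> \<bar>t\<bar> * (C * (1 + \<bar>t\<bar>) powr (-3))"
      using bound by (intro mult_left_mono) auto
    ultimately show "norm (\<bar>t\<bar> * cmod (g t)) \<le> norm (C * inverse (1 + t\<^sup>2))"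
      using \<open>0 \<le> C\<close> by (simp add: mult_ac abs_mult)
  qed
qed measurable

section \<open>From rational relations to patterns\<close>

text \<open>The vanishing sum says that \<open>x0\<close> is the mean of \<open>A\<close> with
  weights \<open>w\<close>. The weights become the coefficients of the points of \<open>A\<close>,
  and their total that of \<open>x0\<close>. Division by the gcd of the weights makes the
  coefficients coprime.\<close>

lemma pattern_of_weighted_mean:
  fixes w :: "real \<Rightarrow> nat"
  assumes A: "finite A" "2 \<le> card A" "A \<subseteq> E" and x0: "x0 \<in> E" "x0 \<notin> A"
    and w: "\<And>y. y \<in> A \<Longrightarrow> 0 < w y" and mean: "(\<Sum>y\<in>A. real (w y) * (y - x0)) = 0"
  shows "\<exists>v\<ge>2. \<exists>f\<in>pattern_functions v. \<exists>x\<in>{0..v} \<rightarrow>\<^sub>E E. inj_on x {0..v} \<and> f x = 0"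
proof -
  define v where "v = card A"
  obtain h where h: "bij_betw h {1..v} A"
    using ex_bij_betw_nat_finite_1[OF A(1)] unfolding v_def by auto
  define g where "g = Gcd (w ` A)"
  have g_dvd: "g dvd w y" if "y \<in> A" for y
    using that by (auto simp: g_def)
  have "g > 0"
  proof -
    obtain y where "y \<in> A" using A by fastforce
    then show ?thesis using g_dvd[of y] w[of y] by (auto intro: gr0I)
  qed
  define m where "m i = (if i = 0 then (\<Sum>y\<in>A. w y div g) else w (h i) div g)" for i
  define x where "x = (\<lambda>i\<in>{0..v}. if i = 0 then x0 else h i)"
  have hA: "h i \<in> A" if "0 < i" "i \<le> v" for i
    using bij_betwE[OF h] that by simp
  have reindex: "(\<Sum>i=1..v. F (h i)) = (\<Sum>y\<in>A. F y)" for F :: "real \<Rightarrow> 'b::comm_monoid_add"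
    using h by (rule sum.reindex_bij_betw)
  have m0: "m 0 = (\<Sum>i=1..v. m i)"
    using reindex[of "\<lambda>y. w y div g"] by (simp add: m_def)
  have m_pos: "1 \<le> m i" if "i \<in> {1..v}" for i
    using that hA[of i] w[of "h i"] g_dvd[of "h i"] \<open>g > 0\<close>
    by (auto simp: m_def div_greater_zero_iff Suc_le_eq dest: dvd_imp_le)
  have "v \<ge> 2" using A by (simp add: v_def)
  have "m 1 \<le> m 0"
    unfolding m0 using \<open>v \<ge> 2\<close> by (intro member_le_sum) auto
  then have m_pos': "1 \<le> m i" if "i \<in> {0..v}" for i
    using m_pos[of i] m_pos[of 1] that \<open>v \<ge> 2\<close> by (cases "i = 0") auto
  \<comment> \<open>A common divisor of the reduced coefficients, multiplied by \<open>g\<close>,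
    divides every weight and hence their gcd \<open>g\<close>. This forces it to be 1.\<close>
  have "Gcd (m ` {0..v}) * g dvd w y" if "y \<in> A" for y
  proof -
    have "y \<in> h ` {1..v}"
      using h that by (simp add: bij_betw_imp_surj_on)
    then obtain i where i: "i \<in> {1..v}" "y = h i"
      by blast
    then have "Gcd (m ` {0..v}) dvd m i"
      by (intro Gcd_dvd imageI) auto
    then have "Gcd (m ` {0..v}) * g dvd m i * g"
      by (rule mult_dvd_mono) simp
    moreover have "m i * g = w y"
      using i g_dvd[OF that] by (simp add: m_def)
    ultimately show ?thesis by simp
  qed
  then have "Gcd (m ` {0..v}) * g dvd Gcd (w ` A)"
    by (intro Gcd_greatest) blast
  then have "Gcd (m ` {0..v}) * g dvd 1 * g"
    by (simp flip: g_def)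
  then have gcd: "Gcd (m ` {0..v}) = 1"
    using \<open>g > 0\<close> by simp
  define f where "f x = real (m 0) * x 0 - (\<Sum>i=1..v. real (m i) * x i)" for x :: "nat \<Rightarrow> real"
  have "f \<in> pattern_functions v"
    unfolding pattern_functions_def f_def using m0 m_pos' gcd by blast
  moreover have "x \<in> {0..v} \<rightarrow>\<^sub>E E"
    using hA A(3) x0 by (force simp: x_def)
  moreover have "inj_on x {0..v}"
  proof -
    have "inj_on h {1..v}" using h by (simp add: bij_betw_def)
    then have "inj_on x {1..v}"
      by (rule inj_on_cong[THEN iffD1, rotated]) (simp add: x_def)
    moreover have "x 0 \<notin> x ` {1..v}"
      using hA x0 by (force simp: x_def)
    moreover have "{0..v} = insert 0 {1..v}"
      by auto
    ultimately show ?thesis by simp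
  qed
  moreover have "f x = 0"
  proof -
    have "f x = real (m 0) * x0 - (\<Sum>i=1..v. real (m i) * h i)"
      by (simp add: f_def x_def)
    also have "\<dots> = - (\<Sum>i=1..v. real (m i) * (h i - x0))"
      by (simp add: m0 sum_distrib_right right_diff_distrib sum_subtractf)
    also have "\<dots> = - (\<Sum>i=1..v. real (w (h i) div g) * (h i - x0))"
      by (simp add: m_def)
    also have "\<dots> = - (\<Sum>y\<in>A. real (w y div g) * (y - x0))"
      using reindex[of "\<lambda>y. real (w y div g) * (y - x0)"] by simp
    also have "\<dots> = - (\<Sum>y\<in>A. real (w y) * (y - x0)) / g"
      using g_dvd by (simp add: real_of_nat_div sum_divide_distrib sum_negf)
    finally show ?thesis using mean by simp
  qed
  ultimately show ?thesis using \<open>v \<ge> 2\<close> by blast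
qed

text \<open>Moving all terms to one side gives a vanishing sum of the differences
  \<open>y - x0\<close>, with weight \<open>M\<close> for each entry of \<open>xs\<close>, an extra
  \<open>p\<close> for \<open>a\<close> and an extra \<open>q\<close> for \<open>b\<close>. Grouping
  equal points adds up their weights. Since \<open>p\<close> and \<open>q\<close> are positive,
  \<open>a\<close> and \<open>b\<close> both survive, so at least two points other than
  \<open>x0\<close> remain.\<close>

lemma pattern_of_list_relation:
  fixes a b x0 :: real
  assumes E: "a \<in> E" "x0 \<in> E" "b \<in> E" "a < x0" "x0 < b" and xs: "set xs \<subseteq> E"
    and pos: "p > 0" "q > 0"
    and rel: "real M * (sum_list xs - length xs * x0) = real p * (x0 - a) - real q * (b - x0)"
  shows "\<exists>v\<ge>2. \<exists>f\<in>pattern_functions v. \<exists>x\<in>{0..v} \<rightarrow>\<^sub>E E. inj_on x {0..v} \<and> f x = 0"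
proof -
  define B where "B = insert a (insert b (set xs))"
  define w where "w y = M * count_list xs y + (if y = a then p else 0) + (if y = b then q else 0)" for y
  \<comment> \<open>x0 may occur in xs; its terms vanish in the sum of the w y * (y - x0).\<close>
  define A where "A = {y \<in> B. y \<noteq> x0 \<and> w y > 0}"
  have sub: "{a, b} \<subseteq> A"
    using E pos by (auto simp: A_def B_def w_def)
  have "(\<Sum>y\<in>A. real (w y) * (y - x0)) = (\<Sum>y\<in>B. real (w y) * (y - x0))"
    by (intro sum.mono_neutral_left) (auto simp: A_def B_def)
  also have "\<dots> = (\<Sum>y\<in>B. real M * (real (count_list xs y) * (y - x0)) +
     (if y = a then real p * (a - x0) else 0) + (if y = b then real q * (b - x0) else 0))"
    by (intro sum.cong) (auto simp: w_def algebra_simps)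
  also have "\<dots> = real M * (\<Sum>y\<in>B. real (count_list xs y) * (y - x0)) + real p * (a - x0) + real q * (b - x0)"
    by (simp add: sum.distrib B_def flip: sum_distrib_left)
  also have "(\<Sum>y\<in>B. real (count_list xs y) * (y - x0)) = sum_list xs - length xs * x0"
  proof -
    have "set xs \<subseteq> B" "finite B" by (auto simp: B_def)
    then show ?thesis
    proof (induction xs)
      case (Cons z zs)
      have "(\<Sum>y\<in>B. real (count_list (z # zs) y) * (y - x0)) =
        (\<Sum>y\<in>B. real (count_list zs y) * (y - x0) + (if y = z then z - x0 else 0))"
        by (intro sum.cong) (auto simp: algebra_simps)
      also have "\<dots> = sum_list zs - length zs * x0 + (z - x0)"
        using Cons by (simp add: sum.distrib)
      finally show ?case by (simp add: algebra_simps)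
    qed simp
  qed
  finally have "(\<Sum>y\<in>A. real (w y) * (y - x0)) = 0"
    using rel by (simp add: algebra_simps)
  moreover have "finite A" by (simp add: A_def B_def)
  moreover have "card {a, b} \<le> card A"
    using sub \<open>finite A\<close> by (intro card_mono)
  moreover have "A \<subseteq> E" using E xs by (auto simp: A_def B_def)
  ultimately show ?thesis
    using E by (intro pattern_of_weighted_mean[of A E x0 w]) (auto simp: A_def)
qed

text \<open>A positive integer \<open>T\<close> is first chosen so large that
  \<open>u + T * \<beta>\<close> is positive, whatever the sign of \<open>u\<close>. A rational
  \<open>r = p / M\<close> is then taken with \<open>r * \<alpha>\<close> above
  \<open>u + T * \<beta>\<close> by less than \<open>e\<close>. Setting \<open>q = M * T\<close>
  puts both coefficients over the denominator \<open>M\<close>.\<close>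

lemma ex_positive_rational_combination:
  fixes \<alpha> \<beta> u e :: real
  assumes "\<alpha> > 0" "\<beta> > 0" "e > 0"
  shows "\<exists>p q M :: nat. p > 0 \<and> q > 0 \<and> M > 0 \<and> \<bar>(real p * \<alpha> - real q * \<beta>) / M - u\<bar> < e"
proof -
  obtain T :: nat where T: "max 0 (- u / \<beta>) < T"
    using reals_Archimedean2 by blast
  then have pos: "u + T * \<beta> > 0" "T > 0"
    using assms by (auto simp: field_simps)
  then obtain r where r: "r \<in> \<rat>" "(u + T * \<beta>) / \<alpha> < r" "r < (u + T * \<beta> + e) / \<alpha>"
    using Rats_dense_in_real[of "(u + T * \<beta>) / \<alpha>" "(u + T * \<beta> + e) / \<alpha>"] assms
    by (auto simp: divide_strict_right_mono)
  have "r > 0"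
    using r(2) pos assms by (meson divide_pos_pos less_trans)
  then obtain p M :: nat where pM: "M \<noteq> 0" "r = p / M"
    using Rats_abs_nat_div_natE[OF r(1)] by (metis abs_of_pos)
  have "(real p * \<alpha> - real (M * T) * \<beta>) / M - u = r * \<alpha> - (u + T * \<beta>)"
    using pM by (simp add: field_simps)
  moreover have "0 < r * \<alpha> - (u + T * \<beta>)" "r * \<alpha> - (u + T * \<beta>) < e"
    using r assms by (simp_all add: field_simps)
  moreover have "p > 0" using \<open>r > 0\<close> pM by (auto intro: gr0I)
  ultimately show ?thesis
    using pM pos by (intro exI[of _ p] exI[of _ "M * T"] exI[of _ M]) auto
qed

section \<open>Interior of a sum set and conclusion\<close>

lemma finite_nfold_sum: "finite E \<Longrightarrow> finite (nfold_sum n E)"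
proof (induction n)
  case (Suc n)
  have "nfold_sum (Suc n) E = (\<lambda>(x, y). x + y) ` (nfold_sum n E \<times> E)"
    by auto
  then show ?case using Suc by simp
qed simp

lemma interior_nfold_sum_nonempty:
  assumes E: "compact E" and \<beta>: "\<beta> > 0" "fourier_decay_exponent E \<beta>"
  shows "\<exists>n. interior (nfold_sum n E) \<noteq> {}"
proof -
  obtain \<mu> C where \<mu>: "real_distribution \<mu>" "emeasure \<mu> E = 1" and "0 < C"
    and decay: "\<And>\<xi>. cmod (fourier_transform \<mu> \<xi>) \<le> C * (1 + \<bar>\<xi>\<bar>) powr (- \<beta> / 2)"
    using \<beta>(2) unfolding fourier_decay_exponent_def by blast
  interpret real_distribution \<mu> by fact
  have \<mu>E: "measure \<mu> E = 1"
    using \<mu>(2) by (simp add: measure_def)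
  have char_le: "cmod (char \<mu> t) \<le> C * (1 + \<bar>t\<bar>) powr (- \<beta> / 2)" for t
    using decay[of "-t"] by (simp add: fourier_transform_conv_char)
  \<comment> \<open>This choice gives \<open>n * \<beta> / 2 > 3\<close>, so the \<open>n\<close>-th
    power of the characteristic function has the decay that \<open>integrable_of_char_decay\<close>
    asks for.\<close>
  obtain n :: nat where n: "6 / \<beta> < n"
    using reals_Archimedean2 by blast
  have "0 < 6 / \<beta>" using \<beta> by simp
  then have "n > 0" using n by linarith
  have n\<beta>: "- \<beta> / 2 * n \<le> - 3"
    using n \<beta> by (simp add: field_simps)
  obtain N where N: "real_distribution N" "\<And>t. char N t = char \<mu> t ^ n"
      "measure N (nfold_sum n E) = 1"
    using ex_iid_sum[OF \<open>n > 0\<close> E \<mu>E] by blast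
  have char_N_le: "cmod (char N t) \<le> C ^ n * (1 + \<bar>t\<bar>) powr (- 3)" for t
  proof -
    have "cmod (char N t) \<le> (C * (1 + \<bar>t\<bar>) powr (- \<beta> / 2)) ^ n"
      unfolding N norm_power using char_le by (intro power_mono) auto
    also have "\<dots> = C ^ n * (1 + \<bar>t\<bar>) powr (- \<beta> / 2 * n)"
      by (simp add: power_mult_distrib powr_power mult.commute)
    also have "\<dots> \<le> C ^ n * (1 + \<bar>t\<bar>) powr (- 3)"
      using \<open>0 < C\<close> n\<beta> by (intro mult_left_mono powr_mono) auto
    finally show ?thesis .
  qed
  have "compact (nfold_sum n E)"
    by (rule compact_nfold_sum[OF E])
  then have "interior (nfold_sum n E) \<noteq> {}"
    using N char_N_le
    by (intro real_distribution.interior_nonempty_of_full_measure[OF N(1)]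
        integrable_of_char_decay real_distribution.char_measurable)
      (auto intro: compact_imp_closed compact_imp_bounded)
  then show ?thesis by blast
qed

theorem corollary1p3:
  fixes E :: "real set"
  assumes "E \<subseteq> {0..1}"
    and "closed E"
    and "fourier_dimension E > 0"
  shows "\<exists>v\<ge>2. \<exists>f\<in>pattern_functions v. \<exists>x\<in>{0..v} \<rightarrow>\<^sub>E E. inj_on x {0..v} \<and> f x = 0"
proof -
  have "compact E"
    using assms(1,2) bounded_subset[OF bounded_closed_interval] by (simp add: compact_eq_bounded_closed)
  moreover obtain \<beta> where "\<beta> > 0" "fourier_decay_exponent E \<beta>"
    using assms(3) unfolding fourier_dimension_def less_Sup_iff by auto
  ultimately obtain n where n: "interior (nfold_sum n E) \<noteq> {}"
    using interior_nfold_sum_nonempty by blast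
  \<comment> \<open>For finite \<open>E\<close> the sum set would be finite too, and a finite set of
    reals has empty interior.\<close>
  have "infinite E"
    using n finite_nfold_sum[of E n] finite_imp_not_open[OF _ open_interior]
      finite_subset[OF interior_subset] by blast
  then obtain B where B: "finite B" "card B = 3" "B \<subseteq> E"
    using infinite_arbitrarily_large by blast
  \<comment> \<open>With the extreme points of a three-element set as \<open>a\<close> and
    \<open>b\<close>, the remaining point lies strictly between them.\<close>
  define a where "a = Min B"
  define b where "b = Max B"
  have "card (B - {a, b}) > 0"
    using B(2) diff_card_le_card_Diff[of "{a, b}" B] card_insert_le_m1[of 2 "{b}" a] by simp
  then obtain x0 where x0: "x0 \<in> B" "x0 \<noteq> a" "x0 \<noteq> b"
    by (metis Diff_iff card_gt_0_iff ex_in_conv insertCI)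
  have ab: "a \<in> B" "b \<in> B" "a < x0" "x0 < b"
    using B(1) x0 Min_in[of B] Max_in[of B] Min_le[of B x0] Max_ge[of B x0]
    unfolding a_def[symmetric] b_def[symmetric] by (auto simp: less_le)
  obtain u where "u \<in> interior (nfold_sum n E)"
    using n by blast
  then obtain e where e: "e > 0" "ball u e \<subseteq> nfold_sum n E"
    by (auto simp: mem_interior)
  \<comment> \<open>The target \<open>u - n * x0\<close> is chosen so that adding
    \<open>n * x0\<close> to the combination gives a point of the ball around \<open>u\<close>,
    hence an \<open>n\<close>-fold sum.\<close>
  obtain p q M :: nat where pqM: "p > 0" "q > 0" "M > 0"
      "\<bar>(real p * (x0 - a) - real q * (b - x0)) / M - (u - n * x0)\<bar> < e"
    using ex_positive_rational_combination[of "x0 - a" "b - x0" e "u - n * x0"] ab e by auto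
  have "n * x0 + (real p * (x0 - a) - real q * (b - x0)) / M \<in> ball u e"
    using pqM(4) by (simp add: dist_real_def abs_minus_commute algebra_simps)
  then obtain xs where xs: "length xs = n" "set xs \<subseteq> E"
      "sum_list xs = n * x0 + (real p * (x0 - a) - real q * (b - x0)) / M"
    using e nfold_sum_imp_list by blast
  then have "real M * (sum_list xs - length xs * x0) = real p * (x0 - a) - real q * (b - x0)"
    using pqM by simp
  then show ?thesis
    using pattern_of_list_relation[of a E x0 b xs p q M] ab x0 B xs pqM by blast
qed

end
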